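(* Let $X$ be a compact metric space, $\infty\in X$ a point, and $f:X\to X$ a homeomorphism fixing $\infty$ such that every point of $X\setminus\{\infty\}$ is wandering. Then $$h_{pol}(f)=\sup_{\mathcal S}\,h^{loc}_{pol}(f;\mathcal S)=\sup_{Y}\,h_{pol}(f;Y),$$ where the first supremum is taken over all finite (non-empty) sets $\mathcal S$ of points of $X\setminus\{\infty\}$, and the second over all (non-empty) compact subsets $Y$ of $X\setminus\{\infty\}$ (suprema being taken in $[0,+\infty]$).
   Context: A set $Y\subset X$ is wandering if $f^n(Y)\cap Y=\emptyset$ for every integer $n\neq0$; a point is wandering if it has a wandering neighborhood. Polynomial entropy: for $\varepsilon>0$ and a positive integer $n$, $E\subset X$ is $(n,\varepsilon)$-separated if for every two distinct $x,y\in E$ there is $k\in\{0,\dots,n-1\}$ with $d(f^k(x),f^k(y))>\varepsilon$; $S(n,\varepsilon)$ is the maximal cardinality of such a set, and $$h_{pol}(f)=\lim_{\varepsilon\to0}\limsup_{n\to\infty}\frac{\log S(n,\varepsilon)}{\log n}.$$ Coding: let $\mathcal F$ be a finite family of non-empty subsets of $X\setminus\{\infty\}$, $\cup\mathcal F$ the union of its elements, and $\infty_{\mathcal F}=X\setminus\cup\mathcal F$. A word $(w_0,\dots,w_{n-1})$ of elements of $\mathcal F\cup\{\infty_{\mathcal F}\}$ is a coding of $(x_0,\dots,x_{n-1})\in X^n$ relative to $\mathcal F$ if $x_k\in w_k$ for all $k=0,\dots,n-1$ (a sequence may have several codings). Let $\mathcal A_n(\mathcal F)$ be the set of all codings of all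 orbits $(x,f(x),\dots,f^{n-1}(x))$, $x\in X$, and $$h_{pol}(f;\mathcal F)=\limsup_{n\to\infty}\frac{\log\sharp\mathcal A_n(\mathcal F)}{\log n},\qquad h_{pol}(f;Y)=h_{pol}(f;\{Y\}).$$ Local polynomial entropy: for $\mathcal S=\{x_1,\dots,x_L\}\subset X\setminus\{\infty\}$, choose for each $\ell$ a decreasing sequence $(U_{\ell,n})_{n\ge0}$ of subsets of $X\setminus\{\infty\}$ forming a basis of neighborhoods of $x_\ell$. Then $$h^{loc}_{pol}(f;\mathcal S)=h^{loc}_{pol}(f;x_1,\dots,x_L)=\lim_{n\to\infty}h_{pol}(f;\{U_{1,n},\dots,U_{L,n}\});$$ this limit exists and does not depend on the choice of the bases. *)

theory Defs
  imports "HOL-Analysis.Analysis"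
begin

text \<open>
  The space is a subset \<open>X\<close> of a metric space, with the induced metric and topology, and
  \<open>p \<in> X\<close> plays the role of the point at infinity. All entropies are extended non-negative
  reals, so that the supremum of the empty set is \<open>0\<close>; the logarithms below are taken of
  numbers \<open>\<ge> 1\<close> as soon as \<open>X\<close> is non-empty.
\<close>

definition int_iter :: "'a set \<Rightarrow> ('a \<Rightarrow> 'a) \<Rightarrow> int \<Rightarrow> 'a \<Rightarrow> 'a" where
  "int_iter X f n = (if n \<ge> 0 then f ^^ nat n else inv_into X f ^^ nat (- n))"

definition wandering_set :: "'a set \<Rightarrow> ('a \<Rightarrow> 'a) \<Rightarrow> 'a set \<Rightarrow> bool" where
  "wandering_set X f Y \<longleftrightarrow> Y \<subseteq> X \<and> (\<forall>n. n \<noteq> 0 \<longrightarrow> int_iter X f n ` Y \<inter> Y = {})"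

text \<open>Neighborhoods are relative to \<open>X\<close> and need not be open.\<close>

definition nbhd_in :: "'a::topological_space set \<Rightarrow> 'a \<Rightarrow> 'a set \<Rightarrow> bool" where
  "nbhd_in X x U \<longleftrightarrow> U \<subseteq> X \<and> (\<exists>V. openin (top_of_set X) V \<and> x \<in> V \<and> V \<subseteq> U)"

definition wandering_point :: "'a::topological_space set \<Rightarrow> ('a \<Rightarrow> 'a) \<Rightarrow> 'a \<Rightarrow> bool" where
  "wandering_point X f x \<longleftrightarrow> (\<exists>U. nbhd_in X x U \<and> wandering_set X f U)"

definition separated :: "('a::metric_space \<Rightarrow> 'a) \<Rightarrow> nat \<Rightarrow> real \<Rightarrow> 'a set \<Rightarrow> bool" where
  "separated f n \<epsilon> E \<longleftrightarrow>
     (\<forall>x\<in>E. \<forall>y\<in>E. x \<noteq> y \<longrightarrow> (\<exists>k<n. dist ((f ^^ k) x) ((f ^^ k) y) > \<epsilon>))"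

text \<open>
  For \<open>X\<close> compact, \<open>f\<close> continuous on \<open>X\<close> and \<open>\<epsilon> > 0\<close>, separated sets are finite with
  bounded cardinality, so the maximum is over a finite set of numbers.
\<close>

definition max_separated :: "'a::metric_space set \<Rightarrow> ('a \<Rightarrow> 'a) \<Rightarrow> nat \<Rightarrow> real \<Rightarrow> nat" where
  "max_separated X f n \<epsilon> = Max {card E |E. E \<subseteq> X \<and> finite E \<and> separated f n \<epsilon> E}"

definition pol_entropy :: "'a::metric_space set \<Rightarrow> ('a \<Rightarrow> 'a) \<Rightarrow> ennreal" where
  "pol_entropy X f =
     Lim (at_right 0) (\<lambda>\<epsilon>. limsup (\<lambda>n. ennreal (ln (real (max_separated X f n \<epsilon>)) / ln (real n))))"

text \<open>The letter \<open>X - \<Union>F\<close> is the complementary symbol of the family \<open>F\<close>.\<close>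

definition is_coding :: "'a set \<Rightarrow> 'a set set \<Rightarrow> 'a set list \<Rightarrow> 'a list \<Rightarrow> bool" where
  "is_coding X F w xs \<longleftrightarrow> set w \<subseteq> insert (X - \<Union>F) F \<and> list_all2 (\<in>) xs w"

definition codings :: "'a set \<Rightarrow> ('a \<Rightarrow> 'a) \<Rightarrow> 'a set set \<Rightarrow> nat \<Rightarrow> 'a set list set" where
  "codings X f F n = {w. \<exists>x\<in>X. is_coding X F w (map (\<lambda>k. (f ^^ k) x) [0..<n])}"

definition pol_entropy_family :: "'a set \<Rightarrow> ('a \<Rightarrow> 'a) \<Rightarrow> 'a set set \<Rightarrow> ennreal" where
  "pol_entropy_family X f F = limsup (\<lambda>n. ennreal (ln (real (card (codings X f F n))) / ln (real n)))"

definition nbhd_basis_seq ::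
    "'a::topological_space set \<Rightarrow> 'a \<Rightarrow> 'a \<Rightarrow> (nat \<Rightarrow> 'a set) \<Rightarrow> bool" where
  "nbhd_basis_seq X p x U \<longleftrightarrow>
     decseq U \<and> (\<forall>n. U n \<subseteq> X - {p} \<and> nbhd_in X x (U n)) \<and>
     (\<forall>W. nbhd_in X x W \<longrightarrow> (\<exists>n. U n \<subseteq> W))"

text \<open>
  The local entropy is the common value of the limit for all choices of the bases of
  neighborhoods \<open>U x\<close> of the points \<open>x \<in> S\<close>.
\<close>

definition local_pol_entropy ::
    "'a::topological_space set \<Rightarrow> 'a \<Rightarrow> ('a \<Rightarrow> 'a) \<Rightarrow> 'a set \<Rightarrow> ennreal" where
  "local_pol_entropy X p f S =
     (THE h. \<forall>U. (\<forall>x\<in>S. nbhd_basis_seq X p x (U x)) \<longrightarrow>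
        (\<lambda>n. pol_entropy_family X f ((\<lambda>x. U x n) ` S)) \<longlonglongrightarrow> h)"

end

theory Submission
  imports Defs
begin

text \<open>
  A compact set avoiding \<open>p\<close> is covered by finitely many wandering sets, so the number of visits
  of an orbit to it is bounded. Under such a bound, the growth rate of the codings relative to
  \<open>F\<close> depends only on \<open>\<Union>F\<close>: it is the growth rate of the number of sets of visit times.

  If \<open>Y\<close> is visited at most \<open>M\<close> times and is cut into small pieces, then each set of visit times
  to \<open>Y\<close> is already realised by \<open>M\<close> pieces, so some union of at most \<open>M\<close> arbitrarily small pieces
  has the full growth rate of \<open>Y\<close>. A limit of the positions of these pieces is a finite set whose
  local entropy is at least that of \<open>Y\<close>.

  For the entropy itself, a separated set injects into the codings relative to a cover of the
  complement of a ball around \<open>p\<close> by small pieces; conversely, shadowing by a maximal separated set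
  controls visit times to \<open>Y\<close> by subsets of the visit times to a neighborhood of \<open>Y\<close>.
\<close>

section \<open>Growth rates and visit times\<close>

definition visits :: "('a \<Rightarrow> 'a) \<Rightarrow> nat \<Rightarrow> 'a set \<Rightarrow> 'a \<Rightarrow> nat set" where
  "visits f n Y x = {k. k < n \<and> (f ^^ k) x \<in> Y}"

definition visit_sets :: "'a set \<Rightarrow> ('a \<Rightarrow> 'a) \<Rightarrow> 'a set \<Rightarrow> nat \<Rightarrow> nat set set" where
  "visit_sets X f Y n = visits f n Y ` X"

text \<open>The coding entropies and the inner limsup of \<open>pol_entropy\<close> all have this
  shape, so every comparison of entropies becomes a comparison of counting sequences.\<close>

definition growth_rate :: "(nat \<Rightarrow> nat) \<Rightarrow> ennreal" where
  "growth_rate a = limsup (\<lambda>n. ennreal (ln (real (a n)) / ln (real n)))"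

definition visit_entropy :: "'a set \<Rightarrow> ('a \<Rightarrow> 'a) \<Rightarrow> 'a set \<Rightarrow> ennreal" where
  "visit_entropy X f Y = growth_rate (\<lambda>n. card (visit_sets X f Y n))"

text \<open>The bound is uniform in the point and in the length \<open>n\<close>, so it enters the
  counts as a constant factor, which growth rates ignore.\<close>

definition bounded_visits :: "'a set \<Rightarrow> ('a \<Rightarrow> 'a) \<Rightarrow> 'a set \<Rightarrow> bool" where
  "bounded_visits X f Y \<longleftrightarrow> (\<exists>M. \<forall>x\<in>X. \<forall>n. card (visits f n Y x) \<le> M)"

text \<open>The factor \<open>C\<close> contributes \<open>ln C / ln n\<close>, which tends to 0,
  and the limsup of a maximum of finitely many sequences is the maximum of their limsups. The index
  in the hypothesis may vary with \<open>n\<close>; the one in the conclusion is fixed.\<close>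

lemma growth_rate_le_finite_family:
  fixes a :: "nat \<Rightarrow> nat" and b :: "'i \<Rightarrow> nat \<Rightarrow> nat" and C :: nat
  assumes "finite I"
    and le: "\<And>n. \<exists>i\<in>I. a n \<le> C * b i n"
    and pos: "\<And>i n. i \<in> I \<Longrightarrow> b i n > 0"
    and C: "C > 0"
  shows "\<exists>i\<in>I. growth_rate a \<le> growth_rate (b i)"
proof (rule ccontr)
  assume "\<not> ?thesis"
  then have lt: "growth_rate (b i) < growth_rate a" if "i \<in> I" for i
    using that by (meson not_le)
  have "I \<noteq> {}"
    using le by blast
  define m where "m = Max ((\<lambda>i. growth_rate (b i)) ` I)"
  have "m < growth_rate a"
    unfolding m_def using \<open>finite I\<close> \<open>I \<noteq> {}\<close> lt by auto
  \<comment> \<open>Two intermediate values are needed: all the \<open>b i\<close> eventually have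
    ratio below \<open>c'\<close>, and the gap between \<open>c'\<close> and \<open>c\<close>
    absorbs \<open>ln C / ln n\<close>.\<close>
  then obtain c where c: "m < c" "c < growth_rate a"
    using dense by blast
  then obtain c' where c': "m < c'" "c' < c"
    using dense by blast
  obtain r where r: "c = ennreal r" "r \<ge> 0"
    using c(2) by (metis ennreal_cases not_top_less)
  obtain r' where r': "c' = ennreal r'" "r' \<ge> 0"
    using c'(2) by (metis ennreal_cases not_top_less)
  have "r' < r"
    using c'(2) r r' by (simp add: ennreal_less_iff)
  have ev1: "\<forall>\<^sub>F n in sequentially. \<forall>i\<in>I. ennreal (ln (real (b i n)) / ln (real n)) < c'"
  proof (intro eventually_ball_finite[OF \<open>finite I\<close>] ballI)
    fix i assume "i \<in> I"
    then have "growth_rate (b i) \<le> m"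
      unfolding m_def using \<open>finite I\<close> by simp
    then show "\<forall>\<^sub>F n in sequentially. ennreal (ln (real (b i n)) / ln (real n)) < c'"
      using c'(1) unfolding growth_rate_def by (intro Limsup_lessD) (rule le_less_trans)
  qed
  have "((\<lambda>n. ln (real C) / ln (real n)) \<longlongrightarrow> 0) sequentially"
    by (intro tendsto_divide_0[OF tendsto_const] filterlim_at_top_imp_at_infinity
        filterlim_compose[OF ln_at_top] filterlim_real_sequentially)
  then have ev2: "\<forall>\<^sub>F n in sequentially. ln (real C) / ln (real n) < r - r'"
    by (rule order_tendstoD) (use \<open>r' < r\<close> in simp)
  have "\<forall>\<^sub>F n in sequentially. ennreal (ln (real (a n)) / ln (real n)) \<le> c"
    using ev1 ev2 eventually_ge_at_top[of 2]
  proof eventually_elim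
    case (elim n)
    obtain i where i: "i \<in> I" "a n \<le> C * b i n"
      using le by blast
    have ln: "ln (real n) > 0"
      using elim by simp
    have bpos: "b i n > 0"
      using pos i by blast
    have "ln (real (a n)) \<le> ln (real C) + ln (real (b i n))"
    \<comment> \<open>Monotonicity of \<open>ln\<close> applies only to positive \<open>a n\<close>;
      in the other case \<open>ln 0 = 0\<close> lies below the non-negative right-hand side.\<close>
    proof (cases "a n = 0")
      case True
      then show ?thesis
        using C bpos by (simp add: Suc_leI)
    next
      case False
      then have "ln (real (a n)) \<le> ln (real (C * b i n))"
        using i(2) by (intro ln_mono) (auto simp del: of_nat_mult)
      also have "\<dots> = ln (real C) + ln (real (b i n))"
        using C bpos by (simp add: ln_mult)
      finally show ?thesis .
    qed
    then have "ln (real (a n)) / ln (real n)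
        \<le> ln (real C) / ln (real n) + ln (real (b i n)) / ln (real n)"
      using ln by (simp add: divide_right_mono flip: add_divide_distrib)
    moreover have "ln (real (b i n)) / ln (real n) < r'"
    proof -
      have "0 \<le> ln (real (b i n)) / ln (real n)"
        using ln bpos by (simp add: Suc_leI)
      moreover have "ennreal (ln (real (b i n)) / ln (real n)) < ennreal r'"
        using elim(1) i(1) r'(1) by blast
      ultimately show ?thesis
        by (metis ennreal_less_iff)
    qed
    ultimately show ?case
      using elim(2) r by (simp add: ennreal_leI)
  qed
  then have "growth_rate a \<le> c"
    unfolding growth_rate_def by (rule Limsup_bounded)
  then show False
    using c(2) by simp
qed

lemma growth_rate_mono:
  fixes a b :: "nat \<Rightarrow> nat"
  assumes "\<And>n. a n \<le> C * b n" and "\<And>n. b n > 0" and "C > 0"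
  shows "growth_rate a \<le> growth_rate b"
  using growth_rate_le_finite_family[of "{()}" a C "\<lambda>_. b"] assms by simp

lemma finite_visits: "finite (visits f n Y x)"
  by (simp add: visits_def)

lemma visits_mono: "Z \<subseteq> Y \<Longrightarrow> visits f n Z x \<subseteq> visits f n Y x"
  by (auto simp: visits_def)

lemma finite_visit_sets: "finite (visit_sets X f Y n)"
  by (rule finite_subset[of _ "Pow {..<n}"]) (auto simp: visit_sets_def visits_def)

lemma card_visit_sets_pos: "X \<noteq> {} \<Longrightarrow> card (visit_sets X f Y n) > 0"
  using finite_visit_sets[of X f Y n] by (auto simp: card_gt_0_iff visit_sets_def)

lemma funpow_in: "f ` X \<subseteq> X \<Longrightarrow> x \<in> X \<Longrightarrow> (f ^^ k) x \<in> X"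
  by (induction k) auto

text \<open>Every visit set is one of the at most \<open>2 ^ M\<close> subsets of some
  \<open>T i\<close>. The index set is later either a family of visit sets of a larger set or a
  spanning set of points.\<close>

lemma card_visit_sets_le:
  assumes M: "\<And>i. i \<in> I \<Longrightarrow> finite (T i) \<and> card (T i) \<le> M"
    and "finite I"
    and cover: "\<And>x. x \<in> X \<Longrightarrow> \<exists>i\<in>I. visits f n Z x \<subseteq> T i"
  shows "card (visit_sets X f Z n) \<le> 2 ^ M * card I"
proof -
  have "card (visit_sets X f Z n) \<le> card (\<Union>i\<in>I. Pow (T i))"
    using assms by (intro card_mono) (auto simp: visit_sets_def)
  also have "\<dots> \<le> (\<Sum>i\<in>I. card (Pow (T i)))"
    by (rule card_UN_le[OF \<open>finite I\<close>])
  also have "\<dots> \<le> (\<Sum>i\<in>I. 2 ^ M)"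
    using M by (intro sum_mono) (simp add: card_Pow)
  finally show ?thesis
    by (simp add: mult.commute)
qed

text \<open>The visits to \<open>Y\<close> do not determine those to \<open>Z\<close>, but leave
  only boundedly many possibilities: the subsets of a set of at most \<open>M\<close> times.\<close>

lemma visit_entropy_mono:
  assumes "Z \<subseteq> Y" and "bounded_visits X f Y" and "X \<noteq> {}"
  shows "visit_entropy X f Z \<le> visit_entropy X f Y"
proof -
  obtain M where M: "\<forall>x\<in>X. \<forall>n. card (visits f n Y x) \<le> M"
    using assms(2) by (auto simp: bounded_visits_def)
  have "card (visit_sets X f Z n) \<le> 2 ^ M * card (visit_sets X f Y n)" for n
  proof (rule card_visit_sets_le[where T = "\<lambda>t. t", OF _ finite_visit_sets])
    show "finite t \<and> card t \<le> M" if "t \<in> visit_sets X f Y n" for t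
      using that M by (auto simp: visit_sets_def finite_visits)
    show "\<exists>t\<in>visit_sets X f Y n. visits f n Z x \<subseteq> t" if "x \<in> X" for x
      using that visits_mono[OF \<open>Z \<subseteq> Y\<close>, of f n x] unfolding visit_sets_def by blast
  qed
  then show ?thesis
    unfolding visit_entropy_def
    by (rule growth_rate_mono) (simp_all add: card_visit_sets_pos assms)
qed

section \<open>Codings\<close>

lemma finite_codings:
  assumes "finite F"
  shows "finite (codings X f F n)"
proof (rule finite_subset)
  show "codings X f F n \<subseteq> {w. set w \<subseteq> insert (X - \<Union>F) F \<and> length w = n}"
    by (auto simp: codings_def is_coding_def dest: list_all2_lengthD)
  show "finite {w. set w \<subseteq> insert (X - \<Union>F) F \<and> length w = n}"
    using assms by (intro finite_lists_length_eq) simp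
qed

lemma is_coding_orbit_iff:
  "is_coding X F w (map (\<lambda>k. (f ^^ k) x) [0..<n]) \<longleftrightarrow>
     length w = n \<and> (\<forall>k<n. w ! k \<in> insert (X - \<Union>F) F \<and> (f ^^ k) x \<in> w ! k)"
  by (auto simp: is_coding_def list_all2_conv_all_nth set_conv_nth)

lemma coding_exists:
  assumes "f ` X \<subseteq> X" and "x \<in> X"
  shows "\<exists>w. is_coding X F w (map (\<lambda>k. (f ^^ k) x) [0..<n])"
proof -
  have "\<exists>A. A \<in> insert (X - \<Union>F) F \<and> (f ^^ k) x \<in> A" for k
    using funpow_in[OF assms, of k] by blast
  then obtain A where "\<And>k. A k \<in> insert (X - \<Union>F) F \<and> (f ^^ k) x \<in> A k"
    by metis
  then show ?thesis
    by (intro exI[of _ "map A [0..<n]"]) (auto simp: is_coding_orbit_iff)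
qed

text \<open>Overlapping elements of \<open>F\<close> leave a choice of letters, but the
  complementary letter is disjoint from all of them, so the times at which it occurs are forced by
  the orbit.\<close>

lemma coding_nth_eq_iff:
  assumes "is_coding X F w (map (\<lambda>k. (f ^^ k) x) [0..<n])" and "k < n"
  shows "w ! k = X - \<Union>F \<longleftrightarrow> k \<notin> visits f n (\<Union>F) x"
  using assms by (auto simp: is_coding_orbit_iff visits_def)

text \<open>Reading off the positions of the non-complementary letters maps codings onto visit
  sets.\<close>

lemma visit_entropy_le_family:
  assumes "finite F" and "f ` X \<subseteq> X" and "X \<noteq> {}"
  shows "visit_entropy X f (\<Union>F) \<le> pol_entropy_family X f F"
proof -
  have le: "card (visit_sets X f (\<Union>F) n) \<le> card (codings X f F n)" for n
  proof (rule surj_card_le[OF finite_codings[OF \<open>finite F\<close>]])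
    show "visit_sets X f (\<Union>F) n \<subseteq> (\<lambda>w. {k. k < n \<and> w ! k \<noteq> X - \<Union>F}) ` codings X f F n"
    proof
      fix T assume "T \<in> visit_sets X f (\<Union>F) n"
      then obtain x where x: "x \<in> X" "T = visits f n (\<Union>F) x"
        by (auto simp: visit_sets_def)
      obtain w where w: "is_coding X F w (map (\<lambda>k. (f ^^ k) x) [0..<n])"
        using coding_exists[OF assms(2) x(1)] by blast
      have "k \<in> T \<longleftrightarrow> k < n \<and> w ! k \<noteq> X - \<Union>F" for k
        using coding_nth_eq_iff[OF w, of k] x(2) by (cases "k < n") (simp_all add: visits_def)
      then have "T = {k. k < n \<and> w ! k \<noteq> X - \<Union>F}"
        by blast
      moreover have "w \<in> codings X f F n"
        using w x(1) by (auto simp: codings_def)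
      ultimately show "T \<in> (\<lambda>w. {k. k < n \<and> w ! k \<noteq> X - \<Union>F}) ` codings X f F n"
        by blast
    qed
  qed
  have "card (codings X f F n) > 0" for n
    using card_visit_sets_pos[OF \<open>X \<noteq> {}\<close>] le less_le_trans by blast
  then show ?thesis
    using growth_rate_mono[of "\<lambda>n. card (visit_sets X f (\<Union>F) n)" 1 "\<lambda>n. card (codings X f F n)"] le
    by (simp add: visit_entropy_def pol_entropy_family_def growth_rate_def)
qed

text \<open>Once the visit set is known, a coding is forced outside it and chooses among
  \<open>card F\<close> letters at each of at most \<open>M\<close> times.\<close>

lemma card_codings_le:
  assumes "finite F" and M: "\<And>x. x \<in> X \<Longrightarrow> card (visits f n (\<Union>F) x) \<le> M"
  shows "card (codings X f F n) \<le> Suc (card F) ^ M * card (visit_sets X f (\<Union>F) n)"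
proof -
  \<comment> \<open>\<open>W T\<close> is the set of words compatible with the visit set
    \<open>T\<close>; such a word is determined by its restriction to \<open>T\<close>.\<close>
  define W where
    "W T = {w. length w = n \<and> (\<forall>k<n. if k \<in> T then w ! k \<in> F else w ! k = X - \<Union>F)}" for T
  let ?T = "visit_sets X f (\<Union>F) n"
  have W: "finite (W T) \<and> card (W T) \<le> Suc (card F) ^ M" if "T \<in> ?T" for T
  proof -
    have T: "finite T" "card T \<le> M" "T \<subseteq> {..<n}"
      using that M by (auto simp: visit_sets_def finite_visits) (auto simp: visits_def)
    have inj: "inj_on (\<lambda>w. restrict ((!) w) T) (W T)"
    proof (rule inj_onI)
      fix v w assume vw: "v \<in> W T" "w \<in> W T" "restrict ((!) v) T = restrict ((!) w) T"
      show "v = w"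
      proof (rule nth_equalityI)
        show "length v = length w"
          using vw by (simp add: W_def)
        fix k assume "k < length v"
        moreover have "v ! k = w ! k" if "k \<in> T"
          using fun_cong[OF vw(3), of k] that by simp
        ultimately show "v ! k = w ! k"
          using vw(1,2) by (cases "k \<in> T") (simp_all add: W_def)
      qed
    qed
    have sub: "(\<lambda>w. restrict ((!) w) T) ` W T \<subseteq> (\<Pi>\<^sub>E k\<in>T. F)"
    proof (rule image_subsetI)
      fix w assume "w \<in> W T"
      then have "\<forall>k<n. if k \<in> T then w ! k \<in> F else w ! k = X - \<Union>F"
        by (simp add: W_def)
      then have "w ! k \<in> F" if "k \<in> T" for k
        using that T(3) by (metis lessThan_iff subsetD)
      then show "restrict ((!) w) T \<in> (\<Pi>\<^sub>E k\<in>T. F)"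
        by (simp add: restrict_PiE_iff)
    qed
    have fin: "finite (\<Pi>\<^sub>E k\<in>T. F)"
      using T(1) \<open>finite F\<close> by (intro finite_PiE) auto
    have "card (W T) \<le> card F ^ card T"
      using card_inj_on_le[OF inj sub fin] T(1) by (simp add: card_PiE)
    \<comment> \<open>The successor keeps the base at least 1, so that the power grows with the
      exponent even for empty \<open>F\<close>.\<close>
    also have "\<dots> \<le> Suc (card F) ^ card T"
      by (rule power_mono) auto
    also have "\<dots> \<le> Suc (card F) ^ M"
      by (rule power_increasing[OF T(2)]) simp
    finally show ?thesis
      using inj_on_finite[OF inj sub fin] by simp
  qed
  have "codings X f F n \<subseteq> (\<Union>T\<in>?T. W T)"
  proof
    fix w assume "w \<in> codings X f F n"
    then obtain x where x: "x \<in> X" and w: "is_coding X F w (map (\<lambda>k. (f ^^ k) x) [0..<n])"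
      by (auto simp: codings_def)
    have "w \<in> W (visits f n (\<Union>F) x)"
      using coding_nth_eq_iff[OF w] w by (auto simp: W_def is_coding_orbit_iff)
    then show "w \<in> (\<Union>T\<in>?T. W T)"
      using x by (auto simp: visit_sets_def)
  qed
  then have "card (codings X f F n) \<le> card (\<Union>T\<in>?T. W T)"
    using W by (intro card_mono) (auto simp: finite_visit_sets)
  also have "\<dots> \<le> (\<Sum>T\<in>?T. card (W T))"
    by (rule card_UN_le[OF finite_visit_sets])
  also have "\<dots> \<le> (\<Sum>T\<in>?T. Suc (card F) ^ M)"
    using W by (intro sum_mono) blast
  finally show ?thesis
    by (simp add: mult.commute)
qed

text \<open>This replaces codings by visit times. It serves for a single compact set, for
  neighborhoods of finitely many points, and for covers by small pieces.\<close>

lemma pol_entropy_family_eq: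
  assumes "finite F" and "f ` X \<subseteq> X" and "X \<noteq> {}" and "bounded_visits X f (\<Union>F)"
  shows "pol_entropy_family X f F = visit_entropy X f (\<Union>F)"
proof (rule antisym)
  obtain M where M: "\<forall>x\<in>X. \<forall>n. card (visits f n (\<Union>F) x) \<le> M"
    using assms(4) by (auto simp: bounded_visits_def)
  show "pol_entropy_family X f F \<le> visit_entropy X f (\<Union>F)"
    using growth_rate_mono[of "\<lambda>n. card (codings X f F n)" "Suc (card F) ^ M"
        "\<lambda>n. card (visit_sets X f (\<Union>F) n)"] card_codings_le[OF assms(1)] M
    by (simp add: visit_entropy_def pol_entropy_family_def growth_rate_def card_visit_sets_pos assms)
  show "visit_entropy X f (\<Union>F) \<le> pol_entropy_family X f F"
    by (rule visit_entropy_le_family[OF assms(1-3)])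
qed

section \<open>Wandering points and local entropy\<close>

lemma bounded_visits_mono: "bounded_visits X f Y \<Longrightarrow> Z \<subseteq> Y \<Longrightarrow> bounded_visits X f Z"
  unfolding bounded_visits_def by (meson card_mono finite_visits visits_mono le_trans)

lemma bounded_visits_empty: "bounded_visits X f {}"
  by (auto simp: bounded_visits_def visits_def)

lemma bounded_visits_Un:
  assumes "bounded_visits X f Y" and "bounded_visits X f Z"
  shows "bounded_visits X f (Y \<union> Z)"
proof -
  obtain M N where M: "\<forall>x\<in>X. \<forall>n. card (visits f n Y x) \<le> M"
    and N: "\<forall>x\<in>X. \<forall>n. card (visits f n Z x) \<le> N"
    using assms by (auto simp: bounded_visits_def)
  have "card (visits f n (Y \<union> Z) x) \<le> M + N" if "x \<in> X" for x n
  proof -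
    have "visits f n (Y \<union> Z) x = visits f n Y x \<union> visits f n Z x"
      by (auto simp: visits_def)
    then show ?thesis
      using card_Un_le[of "visits f n Y x" "visits f n Z x"] M N that
      by (metis add_mono le_trans)
  qed
  then show ?thesis
    unfolding bounded_visits_def by blast
qed

lemma bounded_visits_UN:
  "finite I \<Longrightarrow> (\<And>i. i \<in> I \<Longrightarrow> bounded_visits X f (Y i)) \<Longrightarrow> bounded_visits X f (\<Union>i\<in>I. Y i)"
  by (induction I rule: finite_induct) (auto simp: bounded_visits_empty bounded_visits_Un)

text \<open>An orbit meets \<open>Y\<close> at most once: visits at times \<open>j < k\<close> would
  put the later point into both \<open>Y\<close> and its image under the iterate of order
  \<open>k - j\<close>.\<close>

lemma wandering_set_bounded_visits:
  assumes "wandering_set X f Y"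
  shows "bounded_visits X f Y"
proof -
  have no_return: False if jk: "j < k" "(f ^^ j) x \<in> Y" "(f ^^ k) x \<in> Y" for x j k
  proof -
    have "int_iter X f (int (k - j)) ` Y \<inter> Y = {}"
      using assms jk(1) unfolding wandering_set_def by simp
    moreover have eq: "int_iter X f (int (k - j)) ((f ^^ j) x) = (f ^^ k) x"
    proof -
      have "(f ^^ (k - j)) ((f ^^ j) x) = (f ^^ (k - j + j)) x"
        by (simp only: funpow_add o_apply)
      then show ?thesis
        using jk(1) by (simp add: int_iter_def del: of_nat_diff)
    qed
    moreover have "(f ^^ k) x \<in> int_iter X f (int (k - j)) ` Y"
      using imageI[OF jk(2), of "int_iter X f (int (k - j))"] eq by simp
    ultimately show False
      using jk(3) by blast
  qed
  have "card (visits f n Y x) \<le> Suc 0" for n x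
    unfolding card_le_Suc0_iff_eq[OF finite_visits]
  proof (intro ballI)
    fix j k assume "j \<in> visits f n Y x" "k \<in> visits f n Y x"
    then show "j = k"
      using no_return[of j k x] no_return[of k j x] by (cases j k rule: linorder_cases) (auto simp: visits_def)
  qed
  then show ?thesis
    unfolding bounded_visits_def by blast
qed

lemma nbhd_in_metric_iff:
  fixes X :: "'a::metric_space set"
  assumes "x \<in> X"
  shows "nbhd_in X x U \<longleftrightarrow> U \<subseteq> X \<and> (\<exists>e>0. X \<inter> ball x e \<subseteq> U)"
proof
  assume "nbhd_in X x U"
  then obtain T where "U \<subseteq> X" "open T" "x \<in> T" "X \<inter> T \<subseteq> U"
    by (auto simp: nbhd_in_def openin_open)
  moreover then obtain e where "e > 0" "ball x e \<subseteq> T"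
    by (meson open_contains_ball)
  ultimately show "U \<subseteq> X \<and> (\<exists>e>0. X \<inter> ball x e \<subseteq> U)"
    by blast
next
  assume "U \<subseteq> X \<and> (\<exists>e>0. X \<inter> ball x e \<subseteq> U)"
  then obtain e where "U \<subseteq> X" "e > 0" "X \<inter> ball x e \<subseteq> U"
    by blast
  then show "nbhd_in X x U"
    unfolding nbhd_in_def using assms
    by (intro conjI exI[of _ "X \<inter> ball x e"]) (auto intro: openin_open_Int)
qed

lemma nbhd_in_mono: "nbhd_in X x U \<Longrightarrow> U \<subseteq> W \<Longrightarrow> W \<subseteq> X \<Longrightarrow> nbhd_in X x W"
  unfolding nbhd_in_def by blast

lemma compact_bounded_visits:
  fixes X :: "'a::metric_space set"
  assumes "compact Y" and "Y \<subseteq> X" and "\<And>x. x \<in> Y \<Longrightarrow> wandering_point X f x"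
  shows "bounded_visits X f Y"
proof -
  \<comment> \<open>A wandering neighborhood need not be open, so a ball inside it is used for the
    open cover.\<close>
  have "\<exists>e>0. bounded_visits X f (X \<inter> ball x e)" if x: "x \<in> Y" for x
  proof -
    obtain U where "nbhd_in X x U" "wandering_set X f U"
      using assms(3)[OF x] by (auto simp: wandering_point_def)
    then show ?thesis
      using nbhd_in_metric_iff[of x X U] x \<open>Y \<subseteq> X\<close>
      by (meson bounded_visits_mono subsetD wandering_set_bounded_visits)
  qed
  then obtain e where e: "\<And>x. x \<in> Y \<Longrightarrow> e x > 0 \<and> bounded_visits X f (X \<inter> ball x (e x))"
    by metis
  obtain D where D: "D \<subseteq> Y" "finite D" "Y \<subseteq> (\<Union>x\<in>D. ball x (e x))"
  proof (rule compactE_image[OF \<open>compact Y\<close>, of Y "\<lambda>x. ball x (e x)"])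
    show "Y \<subseteq> (\<Union>x\<in>Y. ball x (e x))"
    proof
      fix y assume "y \<in> Y"
      then show "y \<in> (\<Union>x\<in>Y. ball x (e x))"
        using e by (intro UN_I[of y]) simp_all
    qed
  qed auto
  have "bounded_visits X f (\<Union>x\<in>D. X \<inter> ball x (e x))"
    using D e by (intro bounded_visits_UN) auto
  then show ?thesis
    by (rule bounded_visits_mono) (use D \<open>Y \<subseteq> X\<close> in auto)
qed

section \<open>Neighborhood bases and the local entropy as an infimum\<close>

lemma nbhd_basis_seq_exists:
  fixes X :: "'a::metric_space set"
  assumes "x \<in> X - {p}"
  shows "\<exists>U. nbhd_basis_seq X p x U"
proof -
  \<comment> \<open>The radii never exceed the distance from \<open>x\<close> to \<open>p\<close>,
    so the open balls miss \<open>p\<close>.\<close>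
  define U where "U n = X \<inter> ball x (dist x p / Suc n)" for n
  have pos: "dist x p > 0"
    using assms by auto
  have "decseq U"
  proof (rule decseq_SucI)
    fix n
    have "dist x p / Suc (Suc n) \<le> dist x p / Suc n"
      by (intro divide_left_mono) auto
    then show "U (Suc n) \<subseteq> U n"
      unfolding U_def using subset_ball by blast
  qed
  moreover have "U n \<subseteq> X - {p} \<and> nbhd_in X x (U n)" for n
  proof
    have "dist x p / Suc n \<le> dist x p"
      using divide_left_mono[of 1 "real (Suc n)" "dist x p"] by simp
    then show "U n \<subseteq> X - {p}"
      by (auto simp: U_def)
    have "dist x p / Suc n > 0"
      using pos by simp
    moreover have "U n \<subseteq> X" "X \<inter> ball x (dist x p / Suc n) \<subseteq> U n"
      by (simp_all add: U_def)
    ultimately show "nbhd_in X x (U n)"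
      using assms nbhd_in_metric_iff[of x X "U n"] by blast
  qed
  moreover have "\<exists>n. U n \<subseteq> W" if W: "nbhd_in X x W" for W
  proof -
    obtain e where e: "e > 0" "X \<inter> ball x e \<subseteq> W"
      using W assms nbhd_in_metric_iff[of x X W] by auto
    obtain n where "inverse (real (Suc n)) < e / dist x p"
      using reals_Archimedean[of "e / dist x p"] e pos by auto
    then have "dist x p / Suc n < e"
      using pos by (simp add: field_simps)
    then show ?thesis
      using e(2) by (intro exI[of _ n]) (auto simp: U_def)
  qed
  ultimately show ?thesis
    unfolding nbhd_basis_seq_def by blast
qed

lemma nbhd_basis_seq_eventually:
  assumes "nbhd_basis_seq X p x U" and "nbhd_in X x W"
  shows "\<forall>\<^sub>F n in sequentially. U n \<subseteq> W"
proof -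
  obtain m where "U m \<subseteq> W"
    using assms by (auto simp: nbhd_basis_seq_def)
  then have "U n \<subseteq> W" if "n \<ge> m" for n
    using that assms(1) decseqD[of U m n] unfolding nbhd_basis_seq_def by blast
  then show ?thesis
    by (auto simp: eventually_sequentially)
qed

text \<open>These are common neighborhoods of all points of \<open>S\<close>, restricted to those
  with bounded visits because \<open>visit_entropy\<close> is known to be monotone only below such
  sets.\<close>

definition good_nbhds :: "'a::metric_space set \<Rightarrow> ('a \<Rightarrow> 'a) \<Rightarrow> 'a set \<Rightarrow> 'a set set" where
  "good_nbhds X f S = {V. bounded_visits X f V \<and> (\<forall>x\<in>S. nbhd_in X x V)}"

text \<open>For any bases, the unions of the chosen neighborhoods eventually belong to
  \<open>good_nbhds X f S\<close> and eventually lie inside each given member of it. Monotonicity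
  then forces convergence to the infimum, which does not involve the bases; this gives existence and
  independence of the limit together.\<close>

lemma local_pol_entropy_eq:
  fixes X :: "'a::metric_space set"
  assumes "finite S" and "S \<subseteq> X - {p}" and "X \<noteq> {}" and inv: "f ` X \<subseteq> X"
    and wand: "\<And>x. x \<in> S \<Longrightarrow> wandering_point X f x"
  shows "local_pol_entropy X p f S = (INF V\<in>good_nbhds X f S. visit_entropy X f V)"
proof -
  let ?h = "INF V\<in>good_nbhds X f S. visit_entropy X f V"
  define F where "F U n = (\<lambda>x. U x n) ` S" for U :: "'a \<Rightarrow> nat \<Rightarrow> 'a set" and n
  have lim: "(\<lambda>n. pol_entropy_family X f (F U n)) \<longlonglongrightarrow> ?h"
    if U: "\<forall>x\<in>S. nbhd_basis_seq X p x (U x)" for U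
  proof -
    \<comment> \<open>Each \<open>U x n\<close> eventually lies in a wandering neighborhood of
      \<open>x\<close>, and finiteness of \<open>S\<close> makes this simultaneous.\<close>
    have "\<forall>\<^sub>F n in sequentially. \<forall>x\<in>S. bounded_visits X f (U x n)"
    proof (intro eventually_ball_finite[OF \<open>finite S\<close>] ballI)
      fix x assume "x \<in> S"
      then obtain W where W: "nbhd_in X x W" "wandering_set X f W"
        using wand by (auto simp: wandering_point_def)
      show "\<forall>\<^sub>F n in sequentially. bounded_visits X f (U x n)"
        using nbhd_basis_seq_eventually[OF U[rule_format, OF \<open>x \<in> S\<close>] W(1)]
        by eventually_elim (use W(2) wandering_set_bounded_visits bounded_visits_mono in blast)
    qed
    then have bdd: "\<forall>\<^sub>F n in sequentially. bounded_visits X f (\<Union>(F U n))"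
      unfolding F_def
      by eventually_elim (use \<open>finite S\<close> in \<open>auto intro: bounded_visits_UN\<close>)
    have eq: "pol_entropy_family X f (F U n) = visit_entropy X f (\<Union>(F U n))"
      if "bounded_visits X f (\<Union>(F U n))" for n
      using that assms by (intro pol_entropy_family_eq) (auto simp: F_def)
    have good: "\<Union>(F U n) \<in> good_nbhds X f S" if "bounded_visits X f (\<Union>(F U n))" for n
    proof -
      have nb: "nbhd_in X x (U x n)" if "x \<in> S" for x
        using U that unfolding nbhd_basis_seq_def by blast
      have "nbhd_in X x (\<Union>(F U n))" if "x \<in> S" for x
      proof (rule nbhd_in_mono[OF nb[OF that]])
        show "U x n \<subseteq> \<Union>(F U n)"
          using that by (auto simp: F_def)
        show "\<Union>(F U n) \<subseteq> X"
          using nb by (auto simp: F_def nbhd_in_def)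
      qed
      then show ?thesis
        using \<open>bounded_visits X f (\<Union>(F U n))\<close> by (auto simp: good_nbhds_def)
    qed
    show ?thesis
    proof (rule order_tendstoI)
      fix a assume "a < ?h"
      show "\<forall>\<^sub>F n in sequentially. a < pol_entropy_family X f (F U n)"
        using bdd
        by eventually_elim (metis \<open>a < ?h\<close> INF_lower eq good less_le_trans)
    next
      fix a assume "?h < a"
      then obtain V where V: "V \<in> good_nbhds X f S" "visit_entropy X f V < a"
        by (auto simp: INF_less_iff)
      have "\<forall>\<^sub>F n in sequentially. \<forall>x\<in>S. U x n \<subseteq> V"
      proof (intro eventually_ball_finite[OF \<open>finite S\<close>] ballI)
        fix x assume "x \<in> S"
        then show "\<forall>\<^sub>F n in sequentially. U x n \<subseteq> V"
          using U V(1) by (intro nbhd_basis_seq_eventually[of X p x]) (auto simp: good_nbhds_def)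
      qed
      then show "\<forall>\<^sub>F n in sequentially. pol_entropy_family X f (F U n) < a"
        using bdd
      proof eventually_elim
        case (elim n)
        have "visit_entropy X f (\<Union>(F U n)) \<le> visit_entropy X f V"
          using elim V(1) \<open>X \<noteq> {}\<close> by (intro visit_entropy_mono) (auto simp: F_def good_nbhds_def)
        then show ?case
          using V(2) eq[OF elim(2)] by simp
      qed
    qed
  qed
  \<comment> \<open>Without an admissible choice of bases every \<open>h\<close> would satisfy the
    defining condition vacuously; one choice makes the limit unique.\<close>
  have "\<forall>x\<in>S. \<exists>U. nbhd_basis_seq X p x U"
    using nbhd_basis_seq_exists assms(2) by blast
  then obtain U0 where U0: "\<forall>x\<in>S. nbhd_basis_seq X p x (U0 x)"
    by metis
  show ?thesis
    unfolding local_pol_entropy_def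
  proof (rule the_equality)
    show "\<forall>U. (\<forall>x\<in>S. nbhd_basis_seq X p x (U x)) \<longrightarrow>
        (\<lambda>n. pol_entropy_family X f ((\<lambda>x. U x n) ` S)) \<longlonglongrightarrow> ?h"
      using lim unfolding F_def by blast
    show "h = ?h" if "\<forall>U. (\<forall>x\<in>S. nbhd_basis_seq X p x (U x)) \<longrightarrow>
        (\<lambda>n. pol_entropy_family X f ((\<lambda>x. U x n) ` S)) \<longlonglongrightarrow> h" for h
      using that U0 lim[OF U0] unfolding F_def by (meson LIMSEQ_unique)
  qed
qed

section \<open>Separated sets\<close>

text \<open>Choose one coding for each point of \<open>E\<close>. Two points with the same coding
  share a letter of diameter at most \<epsilon> at every time, so they cannot be separated.\<close>

lemma separated_card_le_codings:
  assumes "finite F" and "f ` X \<subseteq> X" and "E \<subseteq> X" and "separated f n \<epsilon> E"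
    and small: "\<And>A x y. A \<in> insert (X - \<Union>F) F \<Longrightarrow> x \<in> A \<Longrightarrow> y \<in> A \<Longrightarrow> dist x y \<le> \<epsilon>"
  shows "card E \<le> card (codings X f F n)"
proof -
  have "\<exists>w. is_coding X F w (map (\<lambda>k. (f ^^ k) x) [0..<n])" if "x \<in> E" for x
    using coding_exists[OF assms(2)] that assms(3) by blast
  then obtain c where c: "is_coding X F (c x) (map (\<lambda>k. (f ^^ k) x) [0..<n])" if "x \<in> E" for x
    by metis
  have "inj_on c E"
  proof (rule inj_onI, rule ccontr)
    fix x y assume xy: "x \<in> E" "y \<in> E" "c x = c y" "x \<noteq> y"
    then obtain k where k: "k < n" "dist ((f ^^ k) x) ((f ^^ k) y) > \<epsilon>"
      using assms(4) unfolding separated_def by blast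
    have "c x ! k \<in> insert (X - \<Union>F) F" "(f ^^ k) x \<in> c x ! k" "(f ^^ k) y \<in> c x ! k"
      using c[OF xy(1)] c[OF xy(2)] xy(3) k(1) unfolding is_coding_orbit_iff by auto
    then have "dist ((f ^^ k) x) ((f ^^ k) y) \<le> \<epsilon>"
      by (rule small)
    then show False
      using k(2) by simp
  qed
  moreover have "c ` E \<subseteq> codings X f F n"
    using c assms(3) by (auto simp: codings_def)
  ultimately show ?thesis
    by (rule card_inj_on_le) (rule finite_codings[OF \<open>finite F\<close>])
qed

lemma compact_finite_small_cover:
  fixes Y :: "'a::metric_space set"
  assumes "compact Y" and "\<epsilon> > 0"
  shows "\<exists>F. finite F \<and> \<Union>F = Y \<and> (\<forall>A\<in>F. \<forall>x\<in>A. \<forall>y\<in>A. dist x y \<le> \<epsilon>)"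
proof -
  obtain D where D: "finite D" "D \<subseteq> Y" "Y \<subseteq> (\<Union>c\<in>D. ball c (\<epsilon> / 2))"
    using seq_compact_imp_totally_bounded[OF compact_imp_seq_compact[OF assms(1)]] assms(2)
      half_gt_zero by meson
  let ?F = "(\<lambda>c. Y \<inter> ball c (\<epsilon> / 2)) ` D"
  have "dist x y \<le> \<epsilon>" if "x \<in> ball c (\<epsilon> / 2)" "y \<in> ball c (\<epsilon> / 2)" for x y c
    using that dist_triangle_half_r[of c x \<epsilon> y] by simp
  then have "\<forall>A\<in>?F. \<forall>x\<in>A. \<forall>y\<in>A. dist x y \<le> \<epsilon>"
    by blast
  moreover have "\<Union>?F = Y"
    using D(3) by blast
  ultimately show ?thesis
    using D(1) by (intro exI[of _ ?F]) simp
qed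

text \<open>This makes the \<open>Max\<close> in \<open>max_separated\<close> meaningful. The bound
  is the number of codings relative to a small cover of all of \<open>X\<close>, whose complementary
  letter is empty.\<close>

lemma finite_separated_cards:
  assumes "compact X" and "f ` X \<subseteq> X" and "\<epsilon> > 0"
  shows "finite {card E |E. E \<subseteq> X \<and> finite E \<and> separated f n \<epsilon> E}"
proof -
  obtain F where F: "finite F" "\<Union>F = X" "\<forall>A\<in>F. \<forall>x\<in>A. \<forall>y\<in>A. dist x y \<le> \<epsilon>"
    using compact_finite_small_cover[OF assms(1,3)] by blast
  have "card E \<le> card (codings X f F n)" if "E \<subseteq> X" "separated f n \<epsilon> E" for E
  proof (rule separated_card_le_codings[OF F(1) assms(2) that])
    show "dist x y \<le> \<epsilon>" if "A \<in> insert (X - \<Union>F) F" "x \<in> A" "y \<in> A" for A x y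
      using that F(3) unfolding F(2) by blast
  qed
  then have "{card E |E. E \<subseteq> X \<and> finite E \<and> separated f n \<epsilon> E} \<subseteq> {..card (codings X f F n)}"
    by blast
  then show ?thesis
    by (rule finite_subset) simp
qed

lemma card_le_max_separated:
  assumes "compact X" and "f ` X \<subseteq> X" and "\<epsilon> > 0"
    and "E \<subseteq> X" and "finite E" and "separated f n \<epsilon> E"
  shows "card E \<le> max_separated X f n \<epsilon>"
  unfolding max_separated_def
  by (rule Max_ge[OF finite_separated_cards[OF assms(1-3)]]) (intro CollectI exI[of _ E] conjI refl assms)

lemma max_separated_attained:
  assumes "compact X" and "f ` X \<subseteq> X" and "\<epsilon> > 0"
  shows "\<exists>E. E \<subseteq> X \<and> finite E \<and> separated f n \<epsilon> E \<and> card E = max_separated X f n \<epsilon>"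
proof -
  have "separated f n \<epsilon> {}"
    by (simp add: separated_def)
  then have "{card E |E. E \<subseteq> X \<and> finite E \<and> separated f n \<epsilon> E} \<noteq> {}"
    by blast
  then have "max_separated X f n \<epsilon> \<in> {card E |E. E \<subseteq> X \<and> finite E \<and> separated f n \<epsilon> E}"
    unfolding max_separated_def by (rule Max_in[OF finite_separated_cards[OF assms]])
  then obtain E where "max_separated X f n \<epsilon> = card E" "E \<subseteq> X \<and> finite E \<and> separated f n \<epsilon> E"
    by (elim CollectE exE conjE) (rule that, auto)
  then show ?thesis
    by metis
qed

lemma max_separated_pos:
  assumes "compact X" and "f ` X \<subseteq> X" and "\<epsilon> > 0" and "X \<noteq> {}"
  shows "max_separated X f n \<epsilon> > 0"
proof -
  obtain x where "x \<in> X"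
    using assms(4) by blast
  then have "card {x} \<le> max_separated X f n \<epsilon>"
    by (intro card_le_max_separated assms) (auto simp: separated_def)
  then show ?thesis
    by simp
qed

lemma max_separated_antimono:
  assumes "compact X" and "f ` X \<subseteq> X" and "0 < \<epsilon>" and "\<epsilon> \<le> \<delta>"
  shows "max_separated X f n \<delta> \<le> max_separated X f n \<epsilon>"
proof -
  obtain E where E: "E \<subseteq> X" "finite E" "separated f n \<delta> E" "card E = max_separated X f n \<delta>"
    using max_separated_attained[OF assms(1,2), of \<delta> n] assms(3,4) by auto
  have "separated f n \<epsilon> E"
    using E(3) assms(4) unfolding separated_def by (meson le_less_trans)
  then show ?thesis
    using card_le_max_separated[OF assms(1-3) E(1,2)] E(4) by simp
qed

text \<open>The growth rate can only increase as \<epsilon> decreases, so its limit at 0 from the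
  right is its supremum.\<close>

lemma pol_entropy_eq_SUP:
  assumes "compact X" and "f ` X \<subseteq> X" and "X \<noteq> {}"
  shows "pol_entropy X f = (SUP \<epsilon>\<in>{0<..}. growth_rate (\<lambda>n. max_separated X f n \<epsilon>))"
proof -
  define h where "h \<epsilon> = growth_rate (\<lambda>n. max_separated X f n \<epsilon>)" for \<epsilon>
  have anti: "h \<delta> \<le> h \<epsilon>" if "0 < \<epsilon>" "\<epsilon> \<le> \<delta>" for \<epsilon> \<delta>
    unfolding h_def
    using max_separated_antimono[OF assms(1,2) that] max_separated_pos[OF assms(1,2) that(1) assms(3)]
    by (intro growth_rate_mono[of _ 1]) auto
  have "(h \<longlongrightarrow> (SUP \<epsilon>\<in>{0<..}. h \<epsilon>)) (at_right 0)"
  proof (rule order_tendstoI)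
    fix a assume "a < (SUP \<epsilon>\<in>{0<..}. h \<epsilon>)"
    then obtain \<delta> where \<delta>: "\<delta> > 0" "a < h \<delta>"
      by (auto simp: less_SUP_iff)
    have "a < h \<epsilon>" if "0 < \<epsilon>" "\<epsilon> < \<delta>" for \<epsilon>
      using anti[of \<epsilon> \<delta>] that \<delta>(2) by (auto intro: less_le_trans)
    then show "\<forall>\<^sub>F \<epsilon> in at_right 0. a < h \<epsilon>"
      unfolding eventually_at_right_field using \<delta>(1) by blast
  next
    fix a assume a: "(SUP \<epsilon>\<in>{0<..}. h \<epsilon>) < a"
    have "h \<epsilon> < a" if "0 < \<epsilon>" for \<epsilon>
      by (rule le_less_trans[OF SUP_upper a]) (use that in simp)
    then show "\<forall>\<^sub>F \<epsilon> in at_right 0. h \<epsilon> < a"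
      unfolding eventually_at_right_field by (intro exI[of _ 1]) auto
  qed
  then have "Lim (at_right 0) h = (SUP \<epsilon>\<in>{0<..}. h \<epsilon>)"
    by (intro tendsto_Lim) simp_all
  then show ?thesis
    unfolding h_def[abs_def] pol_entropy_def growth_rate_def .
qed

text \<open>\<open>Y'\<close> contains the closed \<epsilon>-neighborhood of \<open>Y\<close> in
  \<open>X\<close>. If the orbit of \<open>e\<close> stays within \<epsilon> of that of
  \<open>x\<close>, then \<open>x\<close> visits \<open>Y\<close> only at times when
  \<open>e\<close> visits \<open>Y'\<close>, and these leave at most \<open>2 ^ M\<close>
  subsets.\<close>

lemma visit_entropy_le_separated:
  assumes "compact X" and inv: "f ` X \<subseteq> X" and "X \<noteq> {}" and "\<epsilon> > 0"
    and "bounded_visits X f Y'"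
    and near: "\<And>y z. y \<in> Y \<Longrightarrow> z \<in> X \<Longrightarrow> dist y z \<le> \<epsilon> \<Longrightarrow> z \<in> Y'"
  shows "visit_entropy X f Y \<le> growth_rate (\<lambda>n. max_separated X f n \<epsilon>)"
proof -
  obtain M where M: "\<forall>x\<in>X. \<forall>n. card (visits f n Y' x) \<le> M"
    using assms(5) by (auto simp: bounded_visits_def)
  have "card (visit_sets X f Y n) \<le> 2 ^ M * max_separated X f n \<epsilon>" for n
  proof -
    obtain E where E: "E \<subseteq> X" "finite E" "separated f n \<epsilon> E" "card E = max_separated X f n \<epsilon>"
      using max_separated_attained[OF assms(1,2,4)] by blast
    \<comment> \<open>A separated set of maximal cardinality is spanning.\<close>
    have span: "\<exists>e\<in>E. \<forall>k<n. dist ((f ^^ k) x) ((f ^^ k) e) \<le> \<epsilon>" if x: "x \<in> X" for x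
    proof (rule ccontr)
      assume "\<not> ?thesis"
      then have far: "\<exists>k<n. dist ((f ^^ k) x) ((f ^^ k) e) > \<epsilon>" if "e \<in> E" for e
        using that by (meson not_le)
      \<comment> \<open>A point of \<open>E\<close> would have to be at positive distance from
        itself.\<close>
      then have "x \<notin> E"
        using \<open>\<epsilon> > 0\<close> by fastforce
      have "separated f n \<epsilon> (insert x E)"
        using far E(3) unfolding separated_def by (metis dist_commute insert_iff)
      then have "card (insert x E) \<le> max_separated X f n \<epsilon>"
        using E x by (intro card_le_max_separated assms) auto
      then show False
        using E \<open>x \<notin> E\<close> by simp
    qed
    have "card (visit_sets X f Y n) \<le> 2 ^ M * card E"
    proof (rule card_visit_sets_le[where T = "visits f n Y'", OF _ E(2)])
      show "finite (visits f n Y' e) \<and> card (visits f n Y' e) \<le> M" if "e \<in> E" for e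
        using that M E(1) by (auto simp: finite_visits)
      show "\<exists>e\<in>E. visits f n Y x \<subseteq> visits f n Y' e" if x: "x \<in> X" for x
      proof -
        obtain e where e: "e \<in> E" "\<forall>k<n. dist ((f ^^ k) x) ((f ^^ k) e) \<le> \<epsilon>"
          using span[OF x] by blast
        have "(f ^^ k) e \<in> X" for k
          using funpow_in[OF inv] e(1) E(1) by blast
        then have "visits f n Y x \<subseteq> visits f n Y' e"
          using e(2) near unfolding visits_def by blast
        then show ?thesis
          using e(1) by blast
      qed
    qed
    then show ?thesis
      using E(4) by simp
  qed
  then show ?thesis
    unfolding visit_entropy_def
    by (rule growth_rate_mono) (simp_all add: max_separated_pos assms)
qed

text \<open>Two points of the ball of radius \<epsilon>/2 around \<open>p\<close> are less than
  \<epsilon> apart, so the ball can be the complementary letter; the compact rest is cut into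
  finitely many small pieces.\<close>

lemma separated_le_visit_entropy:
  assumes "compact X" and inv: "f ` X \<subseteq> X" and "X \<noteq> {}" and "\<epsilon> > 0"
    and "bounded_visits X f (X - ball p (\<epsilon> / 2))"
  shows "growth_rate (\<lambda>n. max_separated X f n \<epsilon>) \<le> visit_entropy X f (X - ball p (\<epsilon> / 2))"
proof -
  let ?Y = "X - ball p (\<epsilon> / 2)"
  have "compact ?Y"
    using \<open>compact X\<close> by (intro compact_diff) auto
  obtain F where F: "finite F" "\<Union>F = ?Y" "\<forall>A\<in>F. \<forall>x\<in>A. \<forall>y\<in>A. dist x y \<le> \<epsilon>"
    using compact_finite_small_cover[OF \<open>compact ?Y\<close> \<open>\<epsilon> > 0\<close>] by (elim exE conjE)
  have small: "dist x y \<le> \<epsilon>" if "A \<in> insert (X - \<Union>F) F" "x \<in> A" "y \<in> A" for A x y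
  proof (cases "A \<in> F")
    case True
    then show ?thesis
      using F(3) that(2,3) by blast
  next
    case False
    then have "dist p x < \<epsilon> / 2" "dist p y < \<epsilon> / 2"
      using that F(2) by auto
    then show ?thesis
      using dist_triangle_half_r[of p x \<epsilon> y] by simp
  qed
  have le: "max_separated X f n \<epsilon> \<le> card (codings X f F n)" for n
  proof -
    obtain E where "E \<subseteq> X" "separated f n \<epsilon> E" "card E = max_separated X f n \<epsilon>"
      using max_separated_attained[OF assms(1,2,4)] by blast
    then show ?thesis
      using separated_card_le_codings[OF F(1) inv _ _ small, of E] by simp
  qed
  have "card (codings X f F n) > 0" for n
    using le max_separated_pos[OF assms(1,2,4,3)] less_le_trans by blast
  then have "growth_rate (\<lambda>n. max_separated X f n \<epsilon>) \<le> pol_entropy_family X f F"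
    using growth_rate_mono[of "\<lambda>n. max_separated X f n \<epsilon>" 1 "\<lambda>n. card (codings X f F n)"] le
    by (simp add: pol_entropy_family_def growth_rate_def)
  also have "\<dots> = visit_entropy X f ?Y"
    using pol_entropy_family_eq[OF F(1) inv \<open>X \<noteq> {}\<close>] F(2) assms(5) by simp
  finally show ?thesis .
qed

section \<open>Concentration of the entropy of a compact set near finitely many points\<close>

text \<open>Induction on \<open>M\<close>: take one point out of each \<open>J m\<close>, pass to a
  subsequence along which these points converge, and apply the induction hypothesis to what remains.
  \<open>S\<close> collects the limits.\<close>

lemma finite_sets_subseq_limit:
  fixes K :: "'a::metric_space set" and J :: "nat \<Rightarrow> 'a set"
  assumes "compact K" and "K \<noteq> {}"
    and "\<And>m. J m \<subseteq> K" and "\<And>m. finite (J m)" and "\<And>m. card (J m) \<le> M"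
  shows "\<exists>S r. finite S \<and> S \<subseteq> K \<and> strict_mono (r :: nat \<Rightarrow> nat) \<and>
    (\<forall>e>0. \<forall>\<^sub>F m in sequentially. \<forall>c\<in>J (r m). \<exists>s\<in>S. dist s c < e)"
  using assms(3-5)
proof (induction M arbitrary: J)
  case 0
  then have "J m = {}" for m
    by (meson card_0_eq le_zero_eq)
  then show ?case
    by (intro exI[of _ "{}"] exI[of _ id]) (simp add: strict_mono_def)
next
  case (Suc M)
  \<comment> \<open>If \<open>J m\<close> is empty, any point of \<open>K\<close> stands in for the
    removed one.\<close>
  have "\<exists>c\<in>K. card (J m - {c}) \<le> M" for m
  proof (cases "J m = {}")
    case True
    then show ?thesis
      using \<open>K \<noteq> {}\<close> by auto
  next
    case False
    then obtain c where "c \<in> J m"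
      by blast
    then show ?thesis
      using Suc.prems(1,3)[of m] by (intro bexI[of _ c]) auto
  qed
  then obtain c where c: "c m \<in> K" "card (J m - {c m}) \<le> M" for m
    by metis
  obtain l r where l: "l \<in> K" "strict_mono r" "(c \<circ> r) \<longlonglongrightarrow> l"
    using compact_imp_seq_compact[OF \<open>compact K\<close>] c(1) unfolding seq_compact_def by blast
  have "J (r m) - {c (r m)} \<subseteq> K" "finite (J (r m) - {c (r m)})" "card (J (r m) - {c (r m)}) \<le> M" for m
    using Suc.prems c(2) by auto
  from Suc.IH[of "\<lambda>m. J (r m) - {c (r m)}", OF this]
  obtain S q where S: "finite S" "S \<subseteq> K" "strict_mono (q :: nat \<Rightarrow> nat)"
    "\<And>e. e > 0 \<Longrightarrow> \<forall>\<^sub>F m in sequentially. \<forall>d\<in>J (r (q m)) - {c (r (q m))}. \<exists>s\<in>S. dist s d < e"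
    by blast
  have "\<forall>\<^sub>F m in sequentially. \<forall>d\<in>J ((r \<circ> q) m). \<exists>s\<in>insert l S. dist s d < e" if "e > 0" for e
  proof -
    have "(\<lambda>m. c (r (q m))) \<longlonglongrightarrow> l"
      using LIMSEQ_subseq_LIMSEQ[OF l(3) S(3)] by (simp add: o_def)
    then have "\<forall>\<^sub>F m in sequentially. dist (c (r (q m))) l < e"
      using that by (rule tendstoD)
    then show ?thesis
      using S(4)[OF that]
      by eventually_elim (auto simp: dist_commute)
  qed
  then show ?case
    using S(1,2) l(1) strict_mono_o[OF l(2) S(3)]
    by (intro exI[of _ "insert l S"] exI[of _ "r \<circ> q"]) blast
qed

text \<open>An orbit visits \<open>Y\<close> at most \<open>M\<close> times, so at most
  \<open>M\<close> balls of a finite cover already account for its visits. There are finitely many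
  such choices of balls, and one of them carries the full growth rate. The bound \<open>M\<close> on
  the number of centers does not depend on \<epsilon>.\<close>

lemma visit_entropy_le_few_balls:
  fixes X :: "'a::metric_space set"
  assumes "X \<noteq> {}" and "compact Y" and "\<epsilon> > 0"
    and M: "\<And>x n. x \<in> X \<Longrightarrow> card (visits f n Y x) \<le> M"
  shows "\<exists>J. J \<subseteq> Y \<and> finite J \<and> card J \<le> M \<and>
    visit_entropy X f Y \<le> visit_entropy X f (\<Union>c\<in>J. Y \<inter> ball c \<epsilon>)"
proof -
  obtain D where D: "finite D" "D \<subseteq> Y" "Y \<subseteq> (\<Union>c\<in>D. ball c \<epsilon>)"
    using seq_compact_imp_totally_bounded[OF compact_imp_seq_compact[OF \<open>compact Y\<close>]] \<open>\<epsilon> > 0\<close>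
    by meson
  define I where "I = {J. J \<subseteq> D \<and> card J \<le> M}"
  define Z where "Z J = (\<Union>c\<in>J. Y \<inter> ball c \<epsilon>)" for J
  have "finite I"
    unfolding I_def using D(1) by simp
  have "{} \<in> I"
    by (simp add: I_def)
  have cover: "visit_sets X f Y n \<subseteq> (\<Union>J\<in>I. visit_sets X f (Z J) n)" for n
  proof
    fix T assume "T \<in> visit_sets X f Y n"
    then obtain x where x: "x \<in> X" "T = visits f n Y x"
      by (auto simp: visit_sets_def)
    have "\<exists>c\<in>D. (f ^^ k) x \<in> ball c \<epsilon>" if "k \<in> T" for k
    proof -
      have "(f ^^ k) x \<in> Y"
        using that x(2) by (simp add: visits_def)
      then show ?thesis
        using D(3) by blast
    qed
    then obtain c where c: "\<And>k. k \<in> T \<Longrightarrow> c k \<in> D \<and> (f ^^ k) x \<in> ball (c k) \<epsilon>"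
      by metis
    have "finite T"
      using x(2) by (simp add: finite_visits)
    then have "card (c ` T) \<le> M"
      using M[OF x(1)] x(2) by (meson card_image_le le_trans)
    then have "c ` T \<in> I"
      using c by (auto simp: I_def)
    \<comment> \<open>The selected balls catch every visit to \<open>Y\<close>, and cutting them
      with \<open>Y\<close> creates no further visits.\<close>
    moreover have "T = visits f n (Z (c ` T)) x"
    proof
      show "T \<subseteq> visits f n (Z (c ` T)) x"
        using c x(2) by (fastforce simp: visits_def Z_def)
      show "visits f n (Z (c ` T)) x \<subseteq> T"
        using x(2) by (auto simp: visits_def Z_def)
    qed
    ultimately show "T \<in> (\<Union>J\<in>I. visit_sets X f (Z J) n)"
      using x(1) unfolding visit_sets_def by blast
  qed
  \<comment> \<open>Pigeonhole: the choice with the most visit sets realises at least a fraction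
    \<open>1 / card I\<close> of them, and \<open>card I\<close> does not depend on
    \<open>n\<close>.\<close>
  have "\<exists>J\<in>I. card (visit_sets X f Y n) \<le> card I * card (visit_sets X f (Z J) n)" for n
  proof -
    let ?b = "\<lambda>J. card (visit_sets X f (Z J) n)"
    have "Max (?b ` I) \<in> ?b ` I"
      using \<open>finite I\<close> \<open>{} \<in> I\<close> by (intro Max_in) auto
    then obtain J where J: "J \<in> I" "Max (?b ` I) = ?b J"
      by (rule imageE)
    have max: "?b i \<le> ?b J" if "i \<in> I" for i
      using \<open>finite I\<close> that unfolding J(2)[symmetric] by simp
    have "card (visit_sets X f Y n) \<le> card (\<Union>J\<in>I. visit_sets X f (Z J) n)"
      using cover \<open>finite I\<close> by (intro card_mono) (auto simp: finite_visit_sets)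
    also have "\<dots> \<le> (\<Sum>i\<in>I. ?b i)"
      by (rule card_UN_le[OF \<open>finite I\<close>])
    also have "\<dots> \<le> card I * ?b J"
      using sum_bounded_above[of I ?b "?b J"] max by simp
    finally show ?thesis
      using J(1) by blast
  qed
  then have "\<exists>J\<in>I. visit_entropy X f Y \<le> visit_entropy X f (Z J)"
    unfolding visit_entropy_def
    using \<open>finite I\<close> \<open>{} \<in> I\<close> card_visit_sets_pos[OF \<open>X \<noteq> {}\<close>]
    by (intro growth_rate_le_finite_family) (auto simp: card_gt_0_iff)
  then show ?thesis
    using D(1,2) finite_subset unfolding I_def Z_def by blast
qed

text \<open>Apply the previous lemma with radii tending to 0. The number of centers stays at most
  \<open>M\<close>, so along a subsequence they approach a finite set \<open>S\<close>, and the
  small balls end up inside any given neighborhood of \<open>S\<close>.\<close>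

lemma visit_entropy_attained_locally:
  fixes X :: "'a::metric_space set"
  assumes "X \<noteq> {}" and "compact Y" and "Y \<noteq> {}" and "Y \<subseteq> X" and "bounded_visits X f Y"
  shows "\<exists>S. finite S \<and> S \<noteq> {} \<and> S \<subseteq> Y \<and>
    visit_entropy X f Y \<le> (INF V\<in>good_nbhds X f S. visit_entropy X f V)"
proof -
  obtain M where M: "\<And>x n. x \<in> X \<Longrightarrow> card (visits f n Y x) \<le> M"
    using assms(5) by (auto simp: bounded_visits_def)
  define Z where "Z J m = (\<Union>c\<in>J. Y \<inter> ball c (1 / Suc m))" for J and m :: nat
  have "\<exists>J. J \<subseteq> Y \<and> finite J \<and> card J \<le> M \<and> visit_entropy X f Y \<le> visit_entropy X f (Z J m)" for m
    unfolding Z_def using visit_entropy_le_few_balls[OF assms(1,2) _ M] by simp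
  then obtain J where J: "\<And>m. J m \<subseteq> Y" "\<And>m. finite (J m)" "\<And>m. card (J m) \<le> M"
    "\<And>m. visit_entropy X f Y \<le> visit_entropy X f (Z (J m) m)"
    by metis
  obtain S r where S: "finite S" "S \<subseteq> Y" "strict_mono (r :: nat \<Rightarrow> nat)"
    "\<And>e. e > 0 \<Longrightarrow> \<forall>\<^sub>F m in sequentially. \<forall>c\<in>J (r m). \<exists>s\<in>S. dist s c < e"
    using finite_sets_subseq_limit[where J = J, OF assms(2,3) J(1-3)] by blast
  obtain y0 where "y0 \<in> Y"
    using assms(3) by blast
  have "visit_entropy X f Y \<le> visit_entropy X f V" if V: "V \<in> good_nbhds X f (insert y0 S)" for V
  proof -
    have "\<exists>e>0. X \<inter> ball s e \<subseteq> V" if "s \<in> S" for s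
      using V that S(2) assms(4) nbhd_in_metric_iff[of s X V] by (auto simp: good_nbhds_def)
    then obtain d where d: "\<And>s. s \<in> S \<Longrightarrow> d s > 0 \<and> X \<inter> ball s (d s) \<subseteq> V"
      by metis
    \<comment> \<open>Inserting 1 keeps the minimum over a non-empty set even when \<open>S\<close>
      is empty. Half of \<open>e\<close> is spent on the radius of the balls, half on the distance
      of their centers from \<open>S\<close>.\<close>
    define e where "e = Min (insert 1 (d ` S))"
    have e: "e > 0" "\<And>s. s \<in> S \<Longrightarrow> e \<le> d s"
      using S(1) d by (auto simp: e_def)
    have "(\<lambda>m. 1 / real (Suc (r m))) \<longlonglongrightarrow> 0"
      using LIMSEQ_subseq_LIMSEQ[OF LIMSEQ_inverse_real_of_nat S(3)]
      by (simp add: o_def inverse_eq_divide)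
    then have "\<forall>\<^sub>F m in sequentially. 1 / real (Suc (r m)) < e / 2"
      by (rule order_tendstoD) (use e in simp)
    moreover have "\<forall>\<^sub>F m in sequentially. \<forall>c\<in>J (r m). \<exists>s\<in>S. dist s c < e / 2"
      using e(1) by (intro S(4)) simp
    ultimately have "\<forall>\<^sub>F m in sequentially. Z (J (r m)) (r m) \<subseteq> V"
    proof eventually_elim
      case (elim m)
      show ?case
      proof
        fix z assume "z \<in> Z (J (r m)) (r m)"
        then obtain c where c: "c \<in> J (r m)" "z \<in> Y" "dist c z < 1 / Suc (r m)"
          by (auto simp: Z_def)
        then obtain s where s: "s \<in> S" "dist s c < e / 2"
          using elim(2) by blast
        have "dist s z < d s"
          using dist_triangle[of s z c] c(3) s(2) elim(1) e(2)[OF s(1)] by linarith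
        then show "z \<in> V"
          using d[OF s(1)] c(2) assms(4) by auto
      qed
    qed
    then obtain m where "Z (J (r m)) (r m) \<subseteq> V"
      using eventually_happens' sequentially_bot by blast
    then have "visit_entropy X f (Z (J (r m)) (r m)) \<le> visit_entropy X f V"
      using V assms(1) by (intro visit_entropy_mono) (auto simp: good_nbhds_def)
    then show ?thesis
      using J(4)[of "r m"] by simp
  qed
  \<comment> \<open>The point \<open>y0\<close> only ensures that the finite set is non-empty.\<close>
  then show ?thesis
    using S(1,2) \<open>y0 \<in> Y\<close> by (intro exI[of _ "insert y0 S"]) (auto intro: INF_greatest)
qed

section \<open>Comparison of the three quantities\<close>

lemma compact_subset_Diff_point:
  fixes Y :: "'a::metric_space set"
  assumes "compact Y" and "p \<notin> Y"
  shows "\<exists>e>0. \<forall>y\<in>Y. e \<le> dist p y"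
proof -
  have "open (- Y)"
    using assms(1) by (simp add: compact_imp_closed open_Compl)
  then obtain e where "e > 0" "ball p e \<subseteq> - Y"
    using assms(2) by (meson ComplI open_contains_ball)
  then show ?thesis
    by (intro exI[of _ e]) (auto simp: not_less subset_iff)
qed

theorem proposition2p3:
  fixes X :: "'a::metric_space set" and p :: 'a and f g :: "'a \<Rightarrow> 'a"
  assumes "compact X"
    and "p \<in> X"
    and "homeomorphism X X f g"
    and "f p = p"
    and "\<And>x. x \<in> X - {p} \<Longrightarrow> wandering_point X f x"
  shows "pol_entropy X f =
           (SUP S\<in>{S. finite S \<and> S \<noteq> {} \<and> S \<subseteq> X - {p}}. local_pol_entropy X p f S) \<and>
         (SUP S\<in>{S. finite S \<and> S \<noteq> {} \<and> S \<subseteq> X - {p}}. local_pol_entropy X p f S) =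
           (SUP Y\<in>{Y. compact Y \<and> Y \<noteq> {} \<and> Y \<subseteq> X - {p}}. pol_entropy_family X f {Y})"
proof -
  let ?\<S> = "{S. finite S \<and> S \<noteq> {} \<and> S \<subseteq> X - {p}}"
  let ?\<Y> = "{Y. compact Y \<and> Y \<noteq> {} \<and> Y \<subseteq> X - {p}}"
  have inv: "f ` X \<subseteq> X"
    using assms(3) by (simp add: homeomorphism_def)
  have ne: "X \<noteq> {}"
    using assms(2) by blast
  have bdd: "bounded_visits X f Y" if "compact Y" "Y \<subseteq> X - {p}" for Y
    using that assms(5) by (intro compact_bounded_visits) auto
  have fam: "pol_entropy_family X f {Y} = visit_entropy X f Y" if "compact Y" "Y \<subseteq> X - {p}" for Y
    using pol_entropy_family_eq[of "{Y}", OF _ inv ne] bdd[OF that] by simp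
  have loc: "local_pol_entropy X p f S = (INF V\<in>good_nbhds X f S. visit_entropy X f V)" if "S \<in> ?\<S>" for S
    using that assms(5) by (intro local_pol_entropy_eq ne inv) auto
  have away: "compact (X - ball p e)" "X - ball p e \<subseteq> X - {p}" if "e > 0" for e
    using that assms(1) by (auto intro: compact_diff)
  have local_le: "(SUP S\<in>?\<S>. local_pol_entropy X p f S) \<le> (SUP Y\<in>?\<Y>. pol_entropy_family X f {Y})"
  proof (rule SUP_least)
    fix S assume S: "S \<in> ?\<S>"
    then have "compact S" "p \<notin> S"
      by (auto simp: finite_imp_compact)
    then obtain e where e: "e > 0" "\<And>s. s \<in> S \<Longrightarrow> e \<le> dist p s"
      using compact_subset_Diff_point by metis
    \<comment> \<open>Since \<open>S\<close> is at distance at least \<open>e\<close> from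
      \<open>p\<close>, balls of radius \<open>e / 2\<close> around its points miss the removed
      ball; hence this compact set is a neighborhood of every point of \<open>S\<close>.\<close>
    let ?Y = "X - ball p (e / 2)"
    have Y: "compact ?Y" "?Y \<subseteq> X - {p}"
      using away[of "e / 2"] e(1) by auto
    have nb: "nbhd_in X s ?Y" if s: "s \<in> S" for s
    proof -
      have "X \<inter> ball s (e / 2) \<subseteq> ?Y"
      proof
        fix z assume "z \<in> X \<inter> ball s (e / 2)"
        then show "z \<in> ?Y"
          using dist_triangle[of p s z] e(2)[OF s] by (simp add: dist_commute)
      qed
      then show ?thesis
        using nbhd_in_metric_iff[of s X ?Y] S s e(1) by (auto intro!: exI[of _ "e / 2"])
    qed
    then have "S \<subseteq> ?Y"
      by (auto simp: nbhd_in_def)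
    then have "?Y \<in> ?\<Y>"
      using Y S by blast
    have "?Y \<in> good_nbhds X f S"
      using nb bdd[OF Y] by (simp add: good_nbhds_def)
    then have "local_pol_entropy X p f S \<le> visit_entropy X f ?Y"
      unfolding loc[OF S] by (rule INF_lower)
    also have "\<dots> = pol_entropy_family X f {?Y}"
      using fam[OF Y] by simp
    also have "\<dots> \<le> (SUP Y\<in>?\<Y>. pol_entropy_family X f {Y})"
      using \<open>?Y \<in> ?\<Y>\<close> by (rule SUP_upper)
    finally show "local_pol_entropy X p f S \<le> (SUP Y\<in>?\<Y>. pol_entropy_family X f {Y})" .
  qed
  have local_ge: "(SUP Y\<in>?\<Y>. pol_entropy_family X f {Y}) \<le> (SUP S\<in>?\<S>. local_pol_entropy X p f S)"
  proof (rule SUP_least)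
    fix Y assume Y: "Y \<in> ?\<Y>"
    then have Y': "compact Y" "Y \<subseteq> X - {p}"
      by auto
    then obtain S where S: "finite S" "S \<noteq> {}" "S \<subseteq> Y"
      "visit_entropy X f Y \<le> (INF V\<in>good_nbhds X f S. visit_entropy X f V)"
      using visit_entropy_attained_locally[OF ne, of Y f] Y bdd[OF Y'] by blast
    then have "S \<in> ?\<S>"
      using Y' by blast
    moreover have "pol_entropy_family X f {Y} \<le> local_pol_entropy X p f S"
      using S(4) fam[OF Y'] loc[OF \<open>S \<in> ?\<S>\<close>] by simp
    ultimately show "pol_entropy_family X f {Y} \<le> (SUP S\<in>?\<S>. local_pol_entropy X p f S)"
      by (rule SUP_upper2)
  qed
  have entropy_le: "pol_entropy X f \<le> (SUP Y\<in>?\<Y>. pol_entropy_family X f {Y})"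
    unfolding pol_entropy_eq_SUP[OF assms(1) inv ne]
  proof (rule SUP_least)
    fix \<epsilon> :: real assume "\<epsilon> \<in> {0<..}"
    then have \<epsilon>: "\<epsilon> > 0"
      by simp
    let ?Y = "X - ball p (\<epsilon> / 2)"
    have Y: "compact ?Y" "?Y \<subseteq> X - {p}"
      using away[of "\<epsilon> / 2"] \<epsilon> by auto
    have le: "growth_rate (\<lambda>n. max_separated X f n \<epsilon>) \<le> visit_entropy X f ?Y"
      by (rule separated_le_visit_entropy[OF assms(1) inv ne \<epsilon> bdd[OF Y]])
    show "growth_rate (\<lambda>n. max_separated X f n \<epsilon>) \<le> (SUP Y\<in>?\<Y>. pol_entropy_family X f {Y})"
    \<comment> \<open>The supremum ranges over non-empty sets only. If \<open>?Y\<close> is empty,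
      the only visit set is the empty one, so the growth rate is 0.\<close>
    proof (cases "?Y = {}")
      case True
      have "visit_sets X f {} n = {{}}" for n
        using ne by (auto simp: visit_sets_def visits_def)
      then have "visit_entropy X f ?Y = 0"
        unfolding True by (simp add: visit_entropy_def growth_rate_def Limsup_const)
      then show ?thesis
        using le by simp
    next
      case False
      then show ?thesis
        using Y le fam[OF Y] by (intro SUP_upper2[of ?Y]) auto
    qed
  qed
  have entropy_ge: "(SUP Y\<in>?\<Y>. pol_entropy_family X f {Y}) \<le> pol_entropy X f"
  proof (rule SUP_least)
    fix Y assume "Y \<in> ?\<Y>"
    then have Y: "compact Y" "Y \<subseteq> X - {p}" "p \<notin> Y"
      by auto
    then obtain e where e: "e > 0" "\<And>y. y \<in> Y \<Longrightarrow> e \<le> dist p y"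
      using compact_subset_Diff_point by metis
    \<comment> \<open>Half the distance from \<open>p\<close> to \<open>Y\<close> serves as
      separation scale: points of \<open>X\<close> within \<open>e / 2\<close> of \<open>Y\<close>
      still avoid the ball of radius \<open>e / 2\<close> around \<open>p\<close>, whose complement
      has bounded visits.\<close>
    have e2: "e / 2 > 0"
      using e(1) by simp
    have "pol_entropy_family X f {Y} = visit_entropy X f Y"
      by (rule fam[OF Y(1,2)])
    also have "\<dots> \<le> growth_rate (\<lambda>n. max_separated X f n (e / 2))"
    proof (rule visit_entropy_le_separated[OF assms(1) inv ne e2 bdd[OF away[OF e2]]])
      fix y z assume yz: "y \<in> Y" "z \<in> X" "dist y z \<le> e / 2"
      then show "z \<in> X - ball p (e / 2)"
        using dist_triangle[of p y z] e(2)[OF yz(1)] by (simp add: dist_commute)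
    qed
    also have "\<dots> \<le> pol_entropy X f"
      unfolding pol_entropy_eq_SUP[OF assms(1) inv ne] by (rule SUP_upper) (use e2 in simp)
    finally show "pol_entropy_family X f {Y} \<le> pol_entropy X f" .
  qed
  show ?thesis
    using antisym[OF local_le local_ge] antisym[OF entropy_le entropy_ge] by simp
qed

end
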